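(* Let $V$ be a module over the linear space $W$ admitting a $\star$-multiplicative basis $\mathfrak{B}=\{v_i\}_{i\in I}$ respect to the basis $\mathfrak{B}'=\{w_j\}_{j\in J}$ of $W$. Then $V$ is minimal if and only if the set of indexes $I$ has all of its elements connected (that is, $i$ is connected to $k$ for all $i,k\in I$).
   Context: $\mathbb{F}$ is an arbitrary field; $V$ and $W$ are $\mathbb{F}$-linear spaces of arbitrary (possibly infinite) dimension. $V$ is a module over the linear space $W$ if it is endowed with a bilinear map $V\times W\to V$, $(v,w)\mapsto vw$ (no further axioms). A submodule of $V$ is a linear subspace $Y\subset V$ with $YW\subset Y$. Given a basis $\mathfrak{B}'=\{w_j\}_{j\in J}$ of $W$, a basis $\mathfrak{B}=\{v_i\}_{i\in I}$ of $V$ is multiplicative respect to $\mathfrak{B}'$ if for any $i\in I$, $j\in J$ either $v_iw_j=0$ or $0\neq v_iw_j\in\mathbb{F}v_k$ for some (unique) $k\in I$. A submodule $Y\subset V$ admits a multiplicative basis $\mathfrak{B}_Y$ inherited from $\mathfrak{B}$ if $\mathfrak{B}_Y$ is a multiplicative basis of $Y$ with $\mathfrak{B}_Y\subset\mathfrak{B}$. The module $V$ admitting a multiplicative basis $\mathfrak{B}$ respect to a fixed basis of $W$ is minimal if its unique nonzero submodule admitting a multiplicative basis inherited from $\mathfrak{B}$ is $V$. For each $j\in J$ introduce a new symbol $\overline{j}\notin J$, put $\overline{J}:=\{\overline{j}: j\in J\}$ and $\overline{(\overline{j})}:=j$. Let $\mathcal{P}(I)$ be the power set of $I$. Define $\star: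 I\times(J\,\dot\cup\,\overline{J})\to\mathcal{P}(I)$ as follows: for $i\in I$, $j\in J$, $i\star j:=\emptyset$ if $v_iw_j=0$, and $i\star j:=\{k\}$ if $0\neq v_iw_j\in\mathbb{F}v_k$; for $i\in I$, $\overline{j}\in\overline{J}$, $i\star\overline{j}:=\{k\in I: 0\neq v_kw_j\in\mathbb{F}v_i\}$. Define $\phi:\mathcal{P}(I)\times(J\,\dot\cup\,\overline{J})\to\mathcal{P}(I)$ by $\phi(U,j):=\bigcup_{i\in U}(i\star j)$. The basis $\mathfrak{B}$ is $\star$-multiplicative respect to $\mathfrak{B}'$ if it is multiplicative respect to $\mathfrak{B}'$ and, whenever $a,b\in I$ satisfy $b\in a\star j$ for some $j\in J\,\dot\cup\,\overline{J}$, then $v_b\in v_aW$, where $v_aW=\{v_aw: w\in W\}$. For $i\neq k$ in $I$, a connection from $i$ to $k$ is a finite sequence $\{j_1,\dots,j_n\}$ ($n\geq 1$) of elements of $J\,\dot\cup\,\overline{J}$ such that, with $U_0:=\{i\}$ and $U_m:=\phi(U_{m-1},j_m)$ for $1\le m\le n$: (1) $U_1,\dots,U_{n-1}$ are all nonempty; (2) $k\in U_n$. We say $i$ is connected to $k$ if $i=k$ or there is a connection from $i$ to $k$. *)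

theory Defs
  imports Complex_Main
begin

text \<open>
  The spaces \<open>V\<close> and \<open>W\<close> are types with scalar multiplications \<open>sV\<close> and \<open>sW\<close> over a field,
  as in \<^locale>\<open>vector_space\<close>. Bases are families \<open>v\<close> indexed by sets \<open>I\<close>; index sets may be
  infinite or empty.
\<close>

definition linear_space_module ::
  "('f::field \<Rightarrow> 'v::ab_group_add \<Rightarrow> 'v) \<Rightarrow> ('f \<Rightarrow> 'w::ab_group_add \<Rightarrow> 'w)
    \<Rightarrow> ('v \<Rightarrow> 'w \<Rightarrow> 'v) \<Rightarrow> bool" where
  "linear_space_module sV sW mul \<longleftrightarrow>
     vector_space sV \<and> vector_space sW \<and>
     (\<forall>y. Vector_Spaces.linear sV sV (\<lambda>x. mul x y)) \<and>
     (\<forall>x. Vector_Spaces.linear sW sV (mul x))"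

definition is_submodule ::
  "('f::field \<Rightarrow> 'v::ab_group_add \<Rightarrow> 'v) \<Rightarrow> ('v \<Rightarrow> 'w \<Rightarrow> 'v) \<Rightarrow> 'v set \<Rightarrow> bool" where
  "is_submodule sV mul Y \<longleftrightarrow>
     module.subspace sV Y \<and> (\<forall>y\<in>Y. \<forall>x. mul y x \<in> Y)"

definition indexed_basis ::
  "('f::field \<Rightarrow> 'v::ab_group_add \<Rightarrow> 'v) \<Rightarrow> 'v set \<Rightarrow> ('i \<Rightarrow> 'v) \<Rightarrow> 'i set \<Rightarrow> bool" where
  "indexed_basis s Y v I \<longleftrightarrow>
     inj_on v I \<and> \<not> module.dependent s (v ` I) \<and> module.span s (v ` I) = Y"

text \<open>\<open>x\<close> is a nonzero element of the line spanned by \<open>u\<close>.\<close>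

definition nonzero_multiple ::
  "('f::field \<Rightarrow> 'v::ab_group_add \<Rightarrow> 'v) \<Rightarrow> 'v \<Rightarrow> 'v \<Rightarrow> bool" where
  "nonzero_multiple s x u \<longleftrightarrow> 0 \<noteq> x \<and> x \<in> range (\<lambda>c. s c u)"

text \<open>
  A multiplicative basis of the submodule \<open>Y\<close> (the whole module for \<open>Y = UNIV\<close>) with respect to
  the family \<open>w\<close> on \<open>J\<close>. The index \<open>k\<close> is unique because the \<open>v k\<close> are linearly independent.
\<close>

definition multiplicative_basis ::
  "('f::field \<Rightarrow> 'v::ab_group_add \<Rightarrow> 'v) \<Rightarrow> ('v \<Rightarrow> 'w \<Rightarrow> 'v) \<Rightarrow> ('j \<Rightarrow> 'w) \<Rightarrow> 'j set
    \<Rightarrow> 'v set \<Rightarrow> ('i \<Rightarrow> 'v) \<Rightarrow> 'i set \<Rightarrow> bool" where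
  "multiplicative_basis sV mul w J Y v I \<longleftrightarrow>
     indexed_basis sV Y v I \<and>
     (\<forall>i\<in>I. \<forall>j\<in>J. mul (v i) (w j) = 0 \<or>
        (\<exists>k\<in>I. nonzero_multiple sV (mul (v i) (w j)) (v k)))"

text \<open>A basis contained in \<open>B\<close> is a subset of \<open>B\<close>, viewed as a family indexed by itself.\<close>

definition admits_inherited_basis ::
  "('f::field \<Rightarrow> 'v::ab_group_add \<Rightarrow> 'v) \<Rightarrow> ('v \<Rightarrow> 'w \<Rightarrow> 'v) \<Rightarrow> ('j \<Rightarrow> 'w) \<Rightarrow> 'j set
    \<Rightarrow> 'v set \<Rightarrow> 'v set \<Rightarrow> bool" where
  "admits_inherited_basis sV mul w J B Y \<longleftrightarrow>
     (\<exists>B\<^sub>Y\<subseteq>B. multiplicative_basis sV mul w J Y (\<lambda>x. x) B\<^sub>Y)"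

text \<open>
  No nonzero submodule other than the whole module admits an inherited multiplicative basis. The
  zero module is minimal in this sense; for nonzero modules see \<open>minimal_module_iff_unique\<close> below.
\<close>

definition minimal_module ::
  "('f::field \<Rightarrow> 'v::ab_group_add \<Rightarrow> 'v) \<Rightarrow> ('v \<Rightarrow> 'w \<Rightarrow> 'v) \<Rightarrow> ('j \<Rightarrow> 'w) \<Rightarrow> 'j set
    \<Rightarrow> 'v set \<Rightarrow> bool" where
  "minimal_module sV mul w J B \<longleftrightarrow>
     (\<forall>Y. is_submodule sV mul Y \<and> Y \<noteq> {0} \<and> admits_inherited_basis sV mul w J B Y
        \<longrightarrow> Y = UNIV)"

text \<open>
  The disjoint union of \<open>J\<close> with its copy of barred symbols is \<open>J <+> J\<close>: \<open>Inl j\<close> stands for \<open>j\<close>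
  and \<open>Inr j\<close> for \<open>j\<close> with a bar. For a multiplicative basis the \<open>Inl\<close> set is empty if the
  product vanishes and a singleton otherwise (\<open>star_op_Inl_zero\<close>, \<open>star_op_Inl_eq\<close>).
\<close>

definition star_op ::
  "('f::field \<Rightarrow> 'v::ab_group_add \<Rightarrow> 'v) \<Rightarrow> ('v \<Rightarrow> 'w \<Rightarrow> 'v) \<Rightarrow> ('j \<Rightarrow> 'w)
    \<Rightarrow> ('i \<Rightarrow> 'v) \<Rightarrow> 'i set \<Rightarrow> 'i \<Rightarrow> 'j + 'j \<Rightarrow> 'i set" where
  "star_op sV mul w v I i s =
     (case s of
        Inl j \<Rightarrow> {k \<in> I. nonzero_multiple sV (mul (v i) (w j)) (v k)}
      | Inr j \<Rightarrow> {k \<in> I. nonzero_multiple sV (mul (v k) (w j)) (v i)})"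

definition star_phi ::
  "('f::field \<Rightarrow> 'v::ab_group_add \<Rightarrow> 'v) \<Rightarrow> ('v \<Rightarrow> 'w \<Rightarrow> 'v) \<Rightarrow> ('j \<Rightarrow> 'w)
    \<Rightarrow> ('i \<Rightarrow> 'v) \<Rightarrow> 'i set \<Rightarrow> 'i set \<Rightarrow> 'j + 'j \<Rightarrow> 'i set" where
  "star_phi sV mul w v I U s = (\<Union>i\<in>U. star_op sV mul w v I i s)"

definition star_multiplicative_basis ::
  "('f::field \<Rightarrow> 'v::ab_group_add \<Rightarrow> 'v) \<Rightarrow> ('v \<Rightarrow> 'w \<Rightarrow> 'v) \<Rightarrow> ('j \<Rightarrow> 'w) \<Rightarrow> 'j set
    \<Rightarrow> ('i \<Rightarrow> 'v) \<Rightarrow> 'i set \<Rightarrow> bool" where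
  "star_multiplicative_basis sV mul w J v I \<longleftrightarrow>
     multiplicative_basis sV mul w J UNIV v I \<and>
     (\<forall>a\<in>I. \<forall>b\<in>I. (\<exists>s \<in> J <+> J. b \<in> star_op sV mul w v I a s) \<longrightarrow> v b \<in> range (mul (v a)))"

text \<open>
  With \<open>js = [j\<^sub>1, \<dots>, j\<^sub>n]\<close>, the set \<open>U\<^sub>m\<close> reached from \<open>{i}\<close> after \<open>m\<close> steps is the left fold of
  \<^const>\<open>star_phi\<close> over the first \<open>m\<close> entries.
\<close>

definition is_connection ::
  "('f::field \<Rightarrow> 'v::ab_group_add \<Rightarrow> 'v) \<Rightarrow> ('v \<Rightarrow> 'w \<Rightarrow> 'v) \<Rightarrow> ('j \<Rightarrow> 'w) \<Rightarrow> 'j set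
    \<Rightarrow> ('i \<Rightarrow> 'v) \<Rightarrow> 'i set \<Rightarrow> 'i \<Rightarrow> 'i \<Rightarrow> ('j + 'j) list \<Rightarrow> bool" where
  "is_connection sV mul w J v I i k js \<longleftrightarrow>
     js \<noteq> [] \<and> set js \<subseteq> J <+> J \<and>
     (let U = (\<lambda>m. foldl (star_phi sV mul w v I) {i} (take m js)) in
       (\<forall>m. 1 \<le> m \<and> m < length js \<longrightarrow> U m \<noteq> {}) \<and> k \<in> U (length js))"

definition index_connected ::
  "('f::field \<Rightarrow> 'v::ab_group_add \<Rightarrow> 'v) \<Rightarrow> ('v \<Rightarrow> 'w \<Rightarrow> 'v) \<Rightarrow> ('j \<Rightarrow> 'w) \<Rightarrow> 'j set
    \<Rightarrow> ('i \<Rightarrow> 'v) \<Rightarrow> 'i set \<Rightarrow> 'i \<Rightarrow> 'i \<Rightarrow> bool" where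
  "index_connected sV mul w J v I i k \<longleftrightarrow>
     i = k \<or> (\<exists>js. is_connection sV mul w J v I i k js)"

lemma star_op_Inl_zero:
  assumes "mul (v i) (w j) = 0"
  shows "star_op sV mul w v I i (Inl j) = {}"
  using assms by (simp add: star_op_def nonzero_multiple_def)

lemma nonzero_multiple_unique:
  assumes "vector_space s" "indexed_basis s Y v I" "k \<in> I" "l \<in> I"
    and k: "nonzero_multiple s x (v k)" and l: "nonzero_multiple s x (v l)"
  shows "k = l"
proof (rule ccontr)
  assume "k \<noteq> l"
  interpret vector_space s by fact
  obtain c d where c: "x = s c (v k)" and d: "x = s d (v l)" and "x \<noteq> 0"
    using k l by (auto simp: nonzero_multiple_def)
  then have "c \<noteq> 0" by auto
  have "v k = s (inverse c) (s c (v k))" using \<open>c \<noteq> 0\<close> by simp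
  also have "\<dots> = s (inverse c * d) (v l)" using c d by (metis scale_scale)
  finally have "v k \<in> span {v l}" by (metis span_base span_scale singletonI)
  moreover have "v k \<noteq> v l" and "v k \<in> v ` I"
    using assms(2-4) \<open>k \<noteq> l\<close> by (auto simp: indexed_basis_def inj_on_def)
  then have "{v l} \<subseteq> v ` I - {v k}" using assms(4) by auto
  ultimately have "v k \<in> span (v ` I - {v k})" using span_mono by blast
  then have "dependent (v ` I)" using \<open>v k \<in> v ` I\<close> unfolding dependent_def by blast
  then show False using assms(2) by (simp add: indexed_basis_def)
qed

lemma star_op_Inl_eq:
  assumes "vector_space sV" "indexed_basis sV Y v I" "k \<in> I"
    and "nonzero_multiple sV (mul (v i) (w j)) (v k)"
  shows "star_op sV mul w v I i (Inl j) = {k}"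
  using assms nonzero_multiple_unique[OF assms(1,2)] by (auto simp: star_op_def)

lemma minimal_module_iff_unique:
  fixes sV :: "'f::field \<Rightarrow> 'v::ab_group_add \<Rightarrow> 'v"
  assumes "vector_space sV" "multiplicative_basis sV mul w J UNIV v I"
    and "(UNIV :: 'v set) \<noteq> {0}"
  shows "minimal_module sV mul w J (v ` I) \<longleftrightarrow>
    {Y. is_submodule sV mul Y \<and> Y \<noteq> {0} \<and> admits_inherited_basis sV mul w J (v ` I) Y} = {UNIV}"
proof -
  interpret vector_space sV by fact
  have "is_submodule sV mul UNIV"
    by (simp add: is_submodule_def subspace_UNIV)
  moreover have "multiplicative_basis sV mul w J UNIV (\<lambda>x. x) (v ` I)"
    using assms(2) by (simp add: multiplicative_basis_def indexed_basis_def)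
  then have "admits_inherited_basis sV mul w J (v ` I) UNIV"
    by (auto simp: admits_inherited_basis_def)
  ultimately show ?thesis
    using assms(3) unfolding minimal_module_def by blast
qed

end

theory Submission
  imports Defs
begin

text \<open>
  Join \<open>a\<close> to \<open>b\<close> whenever \<open>b \<in> a \<star> s\<close> for some symbol \<open>s\<close>. Once the empty set is reached a
  sequence of symbols never leaves it, so the nonemptiness condition on connections is automatic
  and \<^const>\<open>index_connected\<close> is just reachability along these edges
  (\<open>index_connected_iff_reachable\<close>). Both directions are then about subspaces spanned by
  sets of indices that are closed under edges.

  If \<open>V\<close> is minimal, consider the span of the basis vectors reachable from a fixed index \<open>i\<close>. A
  nonzero product \<open>v\<^sub>k w\<^sub>j\<close> lies on the line of a neighbour of \<open>k\<close>, so bilinearity makes this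
  span a submodule (\<open>is_submodule_spanI\<close>). It is nonzero and inherits its basis, so it is all of
  \<open>V\<close>; linear independence then leaves no basis vector outside the reachable ones.

  Conversely, a nonzero submodule \<open>Y\<close> with an inherited basis contains some \<open>v\<^sub>i\<close>.
  The \<open>\<star>\<close>-condition says that \<open>v\<^sub>b \<in> v\<^sub>a W\<close> along every edge, also along edges given by barred
  symbols, where multiplication by \<open>w\<^sub>j\<close> leads from \<open>v\<^sub>b\<close> to the line of \<open>v\<^sub>a\<close>. Hence \<open>Y\<close> absorbs everything
  reachable from \<open>i\<close>, that is, the whole basis.
\<close>

definition star_adjacent ::
  "('f::field \<Rightarrow> 'v::ab_group_add \<Rightarrow> 'v) \<Rightarrow> ('v \<Rightarrow> 'w \<Rightarrow> 'v) \<Rightarrow> ('j \<Rightarrow> 'w) \<Rightarrow> 'j set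
    \<Rightarrow> ('i \<Rightarrow> 'v) \<Rightarrow> 'i set \<Rightarrow> 'i \<Rightarrow> 'i \<Rightarrow> bool" where
  "star_adjacent sV mul w J v I a b \<longleftrightarrow> (\<exists>s \<in> J <+> J. b \<in> star_op sV mul w v I a s)"

lemma star_adjacent_in:
  "star_adjacent sV mul w J v I a b \<Longrightarrow> b \<in> I"
  by (auto simp: star_adjacent_def star_op_def)

lemma reachable_in:
  assumes "(star_adjacent sV mul w J v I)\<^sup>*\<^sup>* i k" "i \<in> I"
  shows "k \<in> I"
  using assms by (induction rule: rtranclp_induct) (auto dest: star_adjacent_in)

lemma in_star_phi_iff:
  "k \<in> star_phi sV mul w v I U s \<longleftrightarrow> (\<exists>l\<in>U. k \<in> star_op sV mul w v I l s)"
  by (simp add: star_phi_def)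

lemma foldl_star_phi_empty: "foldl (star_phi sV mul w v I) {} js = {}"
  by (induction js) (auto simp: star_phi_def)

lemma reachable_if_in_foldl_star_phi:
  assumes "k \<in> foldl (star_phi sV mul w v I) U js" "set js \<subseteq> J <+> J"
  shows "\<exists>u\<in>U. (star_adjacent sV mul w J v I)\<^sup>*\<^sup>* u k"
  using assms
proof (induction js arbitrary: k rule: rev_induct)
  case Nil
  then show ?case by auto
next
  case (snoc s js)
  then obtain l where l: "l \<in> foldl (star_phi sV mul w v I) U js" "k \<in> star_op sV mul w v I l s"
    by (auto simp: in_star_phi_iff)
  have "star_adjacent sV mul w J v I l k"
    using l snoc.prems by (auto simp: star_adjacent_def)
  moreover obtain u where "u \<in> U" "(star_adjacent sV mul w J v I)\<^sup>*\<^sup>* u l"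
    using snoc.IH[OF l(1)] snoc.prems(2) by auto
  ultimately show ?case by (meson rtranclp.rtrancl_into_rtrancl)
qed

lemma in_foldl_star_phi_if_reachable:
  assumes "(star_adjacent sV mul w J v I)\<^sup>*\<^sup>* i k"
  shows "\<exists>js. set js \<subseteq> J <+> J \<and> k \<in> foldl (star_phi sV mul w v I) {i} js"
  using assms
proof (induction rule: rtranclp_induct)
  case base
  have "i \<in> foldl (star_phi sV mul w v I) {i} []" by simp
  then show ?case by (metis empty_set empty_subsetI)
next
  case (step l k)
  then obtain js s where "set js \<subseteq> J <+> J" "l \<in> foldl (star_phi sV mul w v I) {i} js"
    "s \<in> J <+> J" "k \<in> star_op sV mul w v I l s"
    by (auto simp: star_adjacent_def)
  then have "set (js @ [s]) \<subseteq> J <+> J \<and> k \<in> foldl (star_phi sV mul w v I) {i} (js @ [s])"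
    by (auto simp: in_star_phi_iff)
  then show ?case by blast
qed

text \<open>
  A path of edges yields a connection because the final set can only be nonempty if no earlier one
  is empty; the path of length zero is the case \<open>i = k\<close>.
\<close>

lemma index_connected_iff_reachable:
  "index_connected sV mul w J v I i k \<longleftrightarrow> (star_adjacent sV mul w J v I)\<^sup>*\<^sup>* i k"
proof
  assume "index_connected sV mul w J v I i k"
  then show "(star_adjacent sV mul w J v I)\<^sup>*\<^sup>* i k"
    using reachable_if_in_foldl_star_phi[of k sV mul w v I "{i}" _ J]
    by (auto simp: index_connected_def is_connection_def Let_def)
next
  let ?fold = "foldl (star_phi sV mul w v I)"
  assume "(star_adjacent sV mul w J v I)\<^sup>*\<^sup>* i k"
  then obtain js where js: "set js \<subseteq> J <+> J" "k \<in> ?fold {i} js"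
    by (blast dest: in_foldl_star_phi_if_reachable)
  have "?fold {i} (take m js) \<noteq> {}" for m
  proof
    assume "?fold {i} (take m js) = {}"
    then have "?fold {i} (take m js @ drop m js) = {}"
      by (simp only: foldl_append foldl_star_phi_empty)
    with js show False by simp
  qed
  then have "is_connection sV mul w J v I i k js" if "js \<noteq> []"
    using js that by (simp add: is_connection_def)
  moreover have "i = k" if "js = []"
    using js that by simp
  ultimately show "index_connected sV mul w J v I i k"
    unfolding index_connected_def by blast
qed

text \<open>
  Bilinearity reduces closure under the action of all of \<open>W\<close> to products of generators: for a
  fixed argument on one side, the arguments on the other side whose product lands in the span of
  \<open>A\<close> form a subspace.
\<close>

lemma is_submodule_spanI:
  assumes "linear_space_module sV sW mul" "module.span sW B = UNIV"
    and closed: "\<And>x y. x \<in> A \<Longrightarrow> y \<in> B \<Longrightarrow> mul x y \<in> module.span sV A"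
  shows "is_submodule sV mul (module.span sV A)"
proof -
  interpret V: vector_space sV using assms(1) by (simp add: linear_space_module_def)
  interpret W: vector_space sW using assms(1) by (simp add: linear_space_module_def)
  have left: "module_hom sV sV (\<lambda>x. mul x y)" and right: "module_hom sW sV (mul x)" for x y
    using assms(1) by (simp_all add: linear_space_module_def linear_iff_module_hom)
  have gen: "mul x y \<in> V.span A" if "x \<in> A" for x y
  proof -
    have "W.span B \<subseteq> mul x -` V.span A"
      using module_hom.subspace_vimage[OF right V.subspace_span] closed that
      by (intro W.span_minimal) auto
    then show ?thesis using assms(2) by auto
  qed
  have "V.span A \<subseteq> (\<lambda>x. mul x y) -` V.span A" for y
    using module_hom.subspace_vimage[OF left V.subspace_span] gen
    by (intro V.span_minimal) auto
  then show ?thesis by (auto simp: is_submodule_def)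
qed

text \<open>
  The line containing a nonzero product \<open>v\<^sub>a w\<^sub>j\<close> belongs to a neighbour of \<open>a\<close> through the unbarred
  symbol \<open>j\<close>, so products never leave the span of the \<open>v\<^sub>a\<close> with \<open>a \<in> C\<close>.
\<close>

lemma adjacency_closed_span:
  assumes "linear_space_module sV sW mul" "indexed_basis sW UNIV w J"
    and mb: "multiplicative_basis sV mul w J UNIV v I" and "C \<subseteq> I"
    and closed: "\<And>a b. a \<in> C \<Longrightarrow> star_adjacent sV mul w J v I a b \<Longrightarrow> b \<in> C"
  shows "is_submodule sV mul (module.span sV (v ` C))"
    and "admits_inherited_basis sV mul w J (v ` I) (module.span sV (v ` C))"
proof -
  interpret vector_space sV using assms(1) by (simp add: linear_space_module_def)
  have product: "mul (v a) (w j) = 0 \<or> (\<exists>b\<in>C. nonzero_multiple sV (mul (v a) (w j)) (v b))"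
    if "a \<in> C" "j \<in> J" for a j
  proof -
    have "b \<in> C" if b: "b \<in> I" "nonzero_multiple sV (mul (v a) (w j)) (v b)" for b
    proof (rule closed[OF \<open>a \<in> C\<close>])
      have "b \<in> star_op sV mul w v I a (Inl j)" using b by (simp add: star_op_def)
      then show "star_adjacent sV mul w J v I a b"
        using \<open>j \<in> J\<close> unfolding star_adjacent_def by blast
    qed
    then show ?thesis
      using mb that \<open>C \<subseteq> I\<close> unfolding multiplicative_basis_def by blast
  qed
  have "mul x y \<in> span (v ` C)" if "x \<in> v ` C" "y \<in> w ` J" for x y
    using that product by (fastforce simp: nonzero_multiple_def intro: span_zero span_scale span_base)
  then show "is_submodule sV mul (span (v ` C))"
    using assms(1,2) by (intro is_submodule_spanI) (auto simp: indexed_basis_def)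
  have "v ` C \<subseteq> v ` I" using \<open>C \<subseteq> I\<close> by blast
  moreover have "independent (v ` C)"
    using mb calculation independent_mono by (auto simp: multiplicative_basis_def indexed_basis_def)
  ultimately show "admits_inherited_basis sV mul w J (v ` I) (span (v ` C))"
    using product unfolding admits_inherited_basis_def multiplicative_basis_def indexed_basis_def
    by (intro exI[of _ "v ` C"]) auto
qed

lemma basis_index_in_if_span:
  assumes "vector_space sV" "indexed_basis sV Y v I" "C \<subseteq> I" "k \<in> I"
    and "v k \<in> module.span sV (v ` C)"
  shows "k \<in> C"
proof (rule ccontr)
  interpret vector_space sV by fact
  assume "k \<notin> C"
  then have "v ` C \<subseteq> v ` I - {v k}"
    using assms(2-4) by (auto simp: indexed_basis_def inj_on_def)
  then have "v k \<in> span (v ` I - {v k})" using assms(5) span_mono by blast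
  then show False using assms(2,4) by (auto simp: indexed_basis_def dependent_def)
qed

text \<open>
  The \<open>\<star>\<close>-condition lets a submodule follow an edge even in the direction opposite to the
  multiplication, since \<open>v\<^sub>b \<in> v\<^sub>a W\<close> and submodules absorb all of \<open>W\<close>.
\<close>

lemma submodule_contains_reachable:
  assumes "star_multiplicative_basis sV mul w J v I" "is_submodule sV mul Y"
    and "(star_adjacent sV mul w J v I)\<^sup>*\<^sup>* i k" "i \<in> I" "v i \<in> Y"
  shows "v k \<in> Y"
  using assms(3)
proof (induction rule: rtranclp_induct)
  case base
  show ?case by fact
next
  case (step a b)
  have "a \<in> I" "b \<in> I"
    using step.hyps \<open>i \<in> I\<close> by (auto intro: reachable_in star_adjacent_in)
  then have "v b \<in> range (mul (v a))"
    using assms(1) step.hyps(2) by (auto simp: star_multiplicative_basis_def star_adjacent_def)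
  then show ?case
    using assms(2) step.IH by (auto simp: is_submodule_def)
qed

theorem theorem2:
  fixes sV :: "'f::field \<Rightarrow> 'v::ab_group_add \<Rightarrow> 'v"
    and sW :: "'f \<Rightarrow> 'w::ab_group_add \<Rightarrow> 'w"
    and mul :: "'v \<Rightarrow> 'w \<Rightarrow> 'v"
    and v :: "'i \<Rightarrow> 'v" and I :: "'i set"
    and w :: "'j \<Rightarrow> 'w" and J :: "'j set"
  assumes "linear_space_module sV sW mul"
    and "indexed_basis sW UNIV w J"
    and "star_multiplicative_basis sV mul w J v I"
  shows "minimal_module sV mul w J (v ` I) \<longleftrightarrow>
    (\<forall>i\<in>I. \<forall>k\<in>I. index_connected sV mul w J v I i k)"
proof -
  interpret vector_space sV using assms(1) by (simp add: linear_space_module_def)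
  let ?reach = "(star_adjacent sV mul w J v I)\<^sup>*\<^sup>*"
  have mb: "multiplicative_basis sV mul w J UNIV v I"
    using assms(3) by (simp add: star_multiplicative_basis_def)
  then have basis: "indexed_basis sV UNIV v I"
    by (simp add: multiplicative_basis_def)
  show ?thesis unfolding index_connected_iff_reachable
  proof (intro iffI ballI)
    fix i k assume min: "minimal_module sV mul w J (v ` I)" and "i \<in> I" "k \<in> I"
    define C where "C = {l. ?reach i l}"
    have "C \<subseteq> I" using \<open>i \<in> I\<close> by (auto simp: C_def intro: reachable_in)
    have closed: "b \<in> C" if "a \<in> C" "star_adjacent sV mul w J v I a b" for a b
      using that by (auto simp: C_def)
    have "v i \<noteq> 0"
      using basis \<open>i \<in> I\<close> dependent_zero by (force simp: indexed_basis_def)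
    moreover have "v i \<in> span (v ` C)" by (auto simp: C_def intro: span_base)
    ultimately have "span (v ` C) \<noteq> {0}" by blast
    moreover have "is_submodule sV mul (span (v ` C))"
      and "admits_inherited_basis sV mul w J (v ` I) (span (v ` C))"
      by (rule adjacency_closed_span[OF assms(1,2) mb \<open>C \<subseteq> I\<close> closed]; assumption)+
    ultimately have "span (v ` C) = UNIV"
      using min unfolding minimal_module_def by blast
    then have "k \<in> C"
      using basis_index_in_if_span[OF vector_space_axioms basis \<open>C \<subseteq> I\<close> \<open>k \<in> I\<close>] by simp
    then show "?reach i k" by (simp add: C_def)
  next
    assume conn: "\<forall>i\<in>I. \<forall>k\<in>I. ?reach i k"
    have "Y = UNIV" if sub: "is_submodule sV mul Y" and "Y \<noteq> {0}"
      and inh: "admits_inherited_basis sV mul w J (v ` I) Y" for Y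
    proof -
      obtain B where B: "B \<subseteq> v ` I" "span B = Y"
        using inh by (auto simp: admits_inherited_basis_def multiplicative_basis_def indexed_basis_def)
      then have "B \<noteq> {}" using \<open>Y \<noteq> {0}\<close> by auto
      then obtain i where i: "i \<in> I" "v i \<in> B" using B(1) by auto
      have "v i \<in> Y" using B(2) i(2) by (auto intro: span_base)
      then have "v ` I \<subseteq> Y"
        using submodule_contains_reachable[OF assms(3) sub] conn i(1) by (intro image_subsetI) blast
      then have "span (v ` I) \<subseteq> Y"
        using sub by (simp add: is_submodule_def span_minimal)
      then show ?thesis using basis by (auto simp: indexed_basis_def)
    qed
    then show "minimal_module sV mul w J (v ` I)"
      by (auto simp: minimal_module_def)
  qed
qed

end
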